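(* Let $F$ be a field, let $A$ be a finite-dimensional algebra over $F$, let $H$ be an additive subgroup of $A$ that spans $A$ as an $F$-vector space, and write $n$ for the dimension of $A$ as an $F$-vector space. Assume that the characteristic $p$ of $F$ is non-zero, and that $A$ is commutative. Then the number of units of $A$ contained in $H$ is at least $(p-1)^n$.
   Context: An algebra over a field $F$ is a ring $A$ (associative with $1$) equipped with a ring homomorphism from $F$ to the center of $A$; it is finite-dimensional if its dimension as an $F$-vector space is finite. An additive subgroup of $A$ is a subgroup of the additive group of $A$; it is not required to be an $F$-subspace. The number of units in $H$ may be infinite. *)

theory Defs
  imports Complex_Main "HOL-Computational_Algebra.Computational_Algebra"
begin

text \<open>
  The sort \<open>{ring, monoid_mult}\<close> is that of associative rings with 1. Unlike \<open>ring_1\<close> it does not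
  require \<open>0 \<noteq> 1\<close>, so the zero algebra is included; \<open>{comm_ring, comm_monoid_mult}\<close> is its
  commutative counterpart.
\<close>

locale algebra_over_field =
  fixes \<phi> :: "'f::field \<Rightarrow> 'a::{ring, monoid_mult}"
  assumes hom_one: "\<phi> 1 = 1"
    and hom_add: "\<phi> (c + d) = \<phi> c + \<phi> d"
    and hom_mult: "\<phi> (c * d) = \<phi> c * \<phi> d"
    and hom_central: "\<phi> c * x = x * \<phi> c"
begin

definition scale :: "'f \<Rightarrow> 'a \<Rightarrow> 'a"
  where "scale c x = \<phi> c * x"

sublocale vector_space scale
  by unfold_locales
    (simp_all add: scale_def hom_one hom_add hom_mult distrib_left distrib_right mult.assoc)

end

locale fin_dim_algebra = algebra_over_field \<phi>
  for \<phi> :: "'f::field \<Rightarrow> 'a::{ring, monoid_mult}" +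
  assumes fin_dim: "\<exists>B. finite B \<and> span B = UNIV"

definition add_subgroup :: "'a::ab_group_add set \<Rightarrow> bool"
  where "add_subgroup H \<longleftrightarrow>
    0 \<in> H \<and> (\<forall>x\<in>H. \<forall>y\<in>H. x + y \<in> H) \<and> (\<forall>x\<in>H. - x \<in> H)"

end

theory Submission
  imports Defs
begin

text \<open>
  A non-unit lies in one of the finitely many maximal ideals, and each maximal ideal is contained in
  the kernel of a linear functional. By the Chinese remainder theorem these functionals can be
  chosen linearly independent, so it is enough to find \<open>(p - 1) ^ n\<close> points avoiding \<open>r\<close> linearly
  independent hyperplanes in the span over the prime field of a basis \<open>E \<subseteq> H\<close>. Induct on \<open>n\<close>: after
  a change of basis over the prime field, the last functional \<open>f\<close> determines some coordinate \<open>x\<^sub>e\<close>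
  on this span, and the other functionals stay independent on the hyperplane \<open>x\<^sub>e = 0\<close>. Of the \<open>p\<close>
  parallel hyperplanes \<open>x\<^sub>e = t\<close> at most one meets the set to be avoided by \<open>f\<close>; apply induction to
  each of the others.
\<close>

section \<open>The prime field\<close>

text \<open>In positive characteristic the image of the naturals is the prime subfield:
  \<open>of_nat (CHAR('f) - 1)\<close> is -1, which gives closure under subtraction.\<close>

definition prime_field :: "'f::field set"
  where "prime_field = range of_nat"

lemma prime_field_0: "0 \<in> prime_field"
  unfolding prime_field_def by (metis of_nat_0 rangeI)

lemma prime_field_1: "1 \<in> prime_field"
  unfolding prime_field_def by (metis of_nat_1 rangeI)

lemma prime_field_add: "x \<in> prime_field \<Longrightarrow> y \<in> prime_field \<Longrightarrow> x + y \<in> prime_field"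
  unfolding prime_field_def by (auto simp flip: of_nat_add)

lemma prime_field_mult: "x \<in> prime_field \<Longrightarrow> y \<in> prime_field \<Longrightarrow> x * y \<in> prime_field"
  unfolding prime_field_def by (auto simp flip: of_nat_mult)

lemma prime_field_sum:
  "(\<And>i. i \<in> A \<Longrightarrow> x i \<in> prime_field) \<Longrightarrow> sum x A \<in> prime_field"
  by (induction A rule: infinite_finite_induct) (auto intro: prime_field_0 prime_field_add)

lemma prime_field_diff:
  assumes "CHAR('f::field) \<noteq> 0" and "(x::'f) \<in> prime_field" and "y \<in> prime_field"
  shows "x - y \<in> prime_field"
proof -
  have "(of_nat (CHAR('f) - 1) :: 'f) + 1 = of_nat (CHAR('f) - 1 + 1)" by simp
  also have "\<dots> = 0" using assms(1) by (simp del: of_nat_add of_nat_Suc)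
  finally have "(of_nat (CHAR('f) - 1) :: 'f) = - 1" by (simp add: eq_neg_iff_add_eq_0)
  then have "(- 1 :: 'f) \<in> prime_field" unfolding prime_field_def by (metis rangeI)
  then have "x + (- 1) * y \<in> prime_field"
    using assms by (intro prime_field_add prime_field_mult)
  then show ?thesis by simp
qed

lemma prime_field_eq:
  assumes "CHAR('f::field) \<noteq> 0"
  shows "(prime_field :: 'f set) = of_nat ` {..<CHAR('f)}"
proof -
  have "(of_nat k :: 'f) \<in> of_nat ` {..<CHAR('f)}" for k
  proof -
    have "(of_nat k :: 'f) = of_nat (CHAR('f) * (k div CHAR('f)) + k mod CHAR('f))" by simp
    also have "\<dots> = of_nat (k mod CHAR('f))" unfolding of_nat_add of_nat_mult by simp
    finally show ?thesis using assms by auto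
  qed
  then show ?thesis unfolding prime_field_def by auto
qed

lemma finite_prime_field: "CHAR('f::field) \<noteq> 0 \<Longrightarrow> finite (prime_field :: 'f set)"
  by (simp add: prime_field_eq)

lemma card_prime_field:
  assumes "CHAR('f::field) \<noteq> 0"
  shows "card (prime_field :: 'f set) = CHAR('f)"
proof -
  have "inj_on (of_nat :: nat \<Rightarrow> 'f) {..<CHAR('f)}"
  proof (rule linorder_inj_onI)
    fix x y assume xy: "x < y" "x \<in> {..<CHAR('f)}" "y \<in> {..<CHAR('f)}"
    show "(of_nat x :: 'f) \<noteq> of_nat y"
    proof
      assume "(of_nat x :: 'f) = of_nat y"
      then have "(of_nat (y - x) :: 'f) = 0" using xy by simp
      then have "CHAR('f) dvd y - x" by (simp add: of_nat_eq_0_iff_char_dvd)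
      then show False using xy by (auto dest!: dvd_imp_le)
    qed
  qed auto
  then show ?thesis using assms by (simp add: prime_field_eq card_image)
qed

section \<open>Exchange of basis vectors and dual families\<close>

context vector_space
begin

text \<open>Otherwise, subtracting the other terms and dividing by \<open>x e\<close> would put
  \<open>e\<close> itself in the span of the rest.\<close>

lemma independent_combination_notin_span:
  assumes "finite E" and "independent E" and "e \<in> E" and "x e \<noteq> 0"
  shows "(\<Sum>d\<in>E. x d *s d) \<notin> span (E - {e})"
proof
  assume "(\<Sum>d\<in>E. x d *s d) \<in> span (E - {e})"
  moreover have "(\<Sum>d\<in>E. x d *s d) = x e *s e + (\<Sum>d\<in>E-{e}. x d *s d)"
    using assms by (simp add: sum.remove)
  moreover have "(\<Sum>d\<in>E-{e}. x d *s d) \<in> span (E - {e})"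
    by (intro span_sum span_scale span_base)
  ultimately have "x e *s e \<in> span (E - {e})"
    by (simp only: span_add_eq2)
  then have "inverse (x e) *s x e *s e \<in> span (E - {e})"
    by (rule span_scale)
  then have "e \<in> span (E - {e})"
    using assms(4) by simp
  then show False
    using assms unfolding dependent_def by blast
qed

text \<open>Steinitz exchange for one vector: \<open>v\<close> enters the span only with the help of
  \<open>e\<close>, so \<open>e\<close> can be solved for in terms of \<open>v\<close> and the
  rest.\<close>

lemma exchange_basis:
  assumes "independent E" and "e \<in> E" and "v \<in> span E" and "v \<notin> span (E - {e})"
  shows "independent (insert v (E - {e}))" and "span (insert v (E - {e})) = span E"
proof -
  have "independent (E - {e})" using assms(1) by (rule independent_mono) auto
  then show "independent (insert v (E - {e}))" using assms(4) by (simp add: independent_insert)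
  have ins: "insert e (E - {e}) = E" using assms(2) by auto
  then have "e \<in> span (insert v (E - {e}))"
    using in_span_insert[of v e "E - {e}"] assms(3,4) by simp
  then have "E \<subseteq> span (insert v (E - {e}))"
    using span_superset[of "insert v (E - {e})"] by auto
  moreover have "insert v (E - {e}) \<subseteq> span E"
    using assms(3) span_superset[of E] by auto
  ultimately show "span (insert v (E - {e})) = span E"
    by (simp add: span_eq)
qed

text \<open>A basis of \<open>M\<close> together with \<open>v\<close> is independent, so a
  functional may be prescribed as 0 on that basis and 1 at \<open>v\<close>.\<close>

lemma ex_functional_vanishing_on_subspace:
  assumes "subspace M" and "v \<notin> M"
  shows "\<exists>f. Vector_Spaces.linear scale (*) f \<and> (\<forall>x\<in>M. f x = 0) \<and> f v = 1"
proof -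
  interpret F: vector_space "(*) :: 'a \<Rightarrow> 'a \<Rightarrow> 'a"
    by unfold_locales (simp_all add: algebra_simps)
  interpret pair: vector_space_pair scale "(*) :: 'a \<Rightarrow> 'a \<Rightarrow> 'a" ..
  obtain B where B: "B \<subseteq> M" "independent B" "M \<subseteq> span B"
    using maximal_independent_subset by blast
  then have spB: "span B = M" using assms(1) span_minimal by blast
  then have "independent (insert v B)" using assms(2) B by (simp add: independent_insert)
  then obtain g where g: "Vector_Spaces.linear scale (*) g"
    "\<forall>x\<in>insert v B. g x = (if x = v then 1 else 0)"
    using pair.linear_independent_extend[of _ "\<lambda>x. if x = v then 1 else 0"] by blast
  have "g x = 0" if "x \<in> M" for x
    using pair.linear_eq_0_on_span[OF g(1)] g(2) that spB assms(2) B(1) by fastforce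
  then show ?thesis using g by auto
qed

text \<open>Each \<open>f i\<close> kills every other \<open>a j\<close>, hence their span, but not
  \<open>a i\<close>. This serves to bound the number of maximal ideals.\<close>

lemma dual_family_imp_independent:
  assumes lin: "\<And>i. i \<in> I \<Longrightarrow> Vector_Spaces.linear scale (*) (f i)"
    and dual: "\<And>i j. i \<in> I \<Longrightarrow> j \<in> I \<Longrightarrow> f i (a j) = (if i = j then 1 else 0)"
  shows "inj_on a I" and "independent (a ` I)"
proof -
  show "inj_on a I" using dual by (metis inj_onI zero_neq_one)
  show "independent (a ` I)"
    unfolding dependent_def
  proof clarify
    fix i assume i: "i \<in> I" "a i \<in> span (a ` I - {a i})"
    interpret F: vector_space "(*) :: 'a \<Rightarrow> 'a \<Rightarrow> 'a"
      by unfold_locales (simp_all add: algebra_simps)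
    interpret pair: vector_space_pair scale "(*) :: 'a \<Rightarrow> 'a \<Rightarrow> 'a" ..
    have "f i x = 0" if "x \<in> a ` I - {a i}" for x
      using that dual i(1) by auto
    then have "f i (a i) = 0"
      using pair.linear_eq_0_on_span[OF lin[OF i(1)]] i(2) by blast
    then show False using dual[OF i(1) i(1)] by simp
  qed
qed

end

section \<open>Counting points over the prime field\<close>

locale positive_char_vector_space = vector_space scale
  for scale :: "'a::field \<Rightarrow> 'b::ab_group_add \<Rightarrow> 'b" (infixr \<open>*s\<close> 75) +
  assumes char: "CHAR('a) \<noteq> 0"
begin

text \<open>For finite \<open>E\<close> this is the additive subgroup generated by \<open>E\<close>:
  a finite set lying inside every additive subgroup that contains \<open>E\<close>. The units are
  sought there.\<close>

definition prime_span :: "'b set \<Rightarrow> 'b set"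
  where "prime_span E = {\<Sum>e\<in>E. x e *s e | x. \<forall>e\<in>E. x e \<in> prime_field}"

lemma prime_spanI:
  "(\<And>e. e \<in> E \<Longrightarrow> x e \<in> prime_field) \<Longrightarrow> (\<Sum>e\<in>E. x e *s e) \<in> prime_span E"
  unfolding prime_span_def by blast

lemma prime_spanE:
  assumes "v \<in> prime_span E"
  obtains x where "v = (\<Sum>e\<in>E. x e *s e)" and "\<And>e. e \<in> E \<Longrightarrow> x e \<in> prime_field"
  using assms unfolding prime_span_def by blast

lemma prime_span_subset_span: "prime_span E \<subseteq> span E"
  unfolding prime_span_def by (auto intro!: span_sum span_scale intro: span_base)

lemma prime_span_base:
  assumes "finite E" and "e \<in> E"
  shows "e \<in> prime_span E"
proof -
  have "(\<Sum>d\<in>E. (if d = e then 1 else 0) *s d) \<in> prime_span E"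
    by (rule prime_spanI) (auto intro: prime_field_0 prime_field_1)
  also have "(\<Sum>d\<in>E. (if d = e then 1 else 0) *s d) = (\<Sum>d\<in>E. if d = e then d else 0)"
    by (rule sum.cong) auto
  also have "\<dots> = e" using assms by simp
  finally show ?thesis .
qed

text \<open>Allows a change of basis inside \<open>prime_span E\<close> without leaving the set of
  points to be counted.\<close>

lemma prime_span_trans:
  assumes "D \<subseteq> prime_span E"
  shows "prime_span D \<subseteq> prime_span E"
proof
  fix v assume "v \<in> prime_span D"
  then obtain x where v: "v = (\<Sum>d\<in>D. x d *s d)" and x: "\<And>d. d \<in> D \<Longrightarrow> x d \<in> prime_field"
    by (rule prime_spanE) blast
  have "\<forall>d\<in>D. \<exists>y. d = (\<Sum>e\<in>E. y e *s e) \<and> (\<forall>e\<in>E. y e \<in> prime_field)"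
    using assms unfolding prime_span_def by blast
  then obtain y where y: "\<And>d. d \<in> D \<Longrightarrow> d = (\<Sum>e\<in>E. y d e *s e)"
      "\<And>d e. d \<in> D \<Longrightarrow> e \<in> E \<Longrightarrow> y d e \<in> prime_field"
    by metis
  have "v = (\<Sum>d\<in>D. x d *s (\<Sum>e\<in>E. y d e *s e))"
    unfolding v by (rule sum.cong) (use y in auto)
  also have "\<dots> = (\<Sum>e\<in>E. (\<Sum>d\<in>D. x d * y d e) *s e)"
    unfolding scale_sum_right scale_sum_left scale_scale by (rule sum.swap)
  also have "\<dots> \<in> prime_span E"
    by (intro prime_spanI prime_field_sum prime_field_mult x y)
  finally show "v \<in> prime_span E" .
qed

lemma finite_prime_span:
  assumes "finite E"
  shows "finite (prime_span E)"
proof -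
  \<comment> \<open>A point depends only on the coefficients on \<open>E\<close>, so the finitely
    many extensional functions on \<open>E\<close> suffice.\<close>
  have "prime_span E \<subseteq> (\<lambda>x. \<Sum>e\<in>E. x e *s e) ` (E \<rightarrow>\<^sub>E prime_field)"
  proof
    fix v assume "v \<in> prime_span E"
    then obtain x where v: "v = (\<Sum>e\<in>E. x e *s e)" and x: "\<And>e. e \<in> E \<Longrightarrow> x e \<in> prime_field"
      by (rule prime_spanE) blast
    have "v = (\<Sum>e\<in>E. restrict x E e *s e)" unfolding v by (rule sum.cong) auto
    moreover have "restrict x E \<in> E \<rightarrow>\<^sub>E prime_field" using x by auto
    ultimately show "v \<in> (\<lambda>x. \<Sum>e\<in>E. x e *s e) ` (E \<rightarrow>\<^sub>E prime_field)" by (rule image_eqI)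
  qed
  then show ?thesis
    using assms char by (meson finite_PiE finite_imageI finite_prime_field finite_subset)
qed

lemma prime_span_insert:
  assumes "finite D" and "e \<notin> D" and "h \<in> prime_span D" and "t \<in> prime_field"
  shows "h + t *s e \<in> prime_span (insert e D)"
proof -
  obtain x where h: "h = (\<Sum>d\<in>D. x d *s d)" and x: "\<And>d. d \<in> D \<Longrightarrow> x d \<in> prime_field"
    using assms(3) by (rule prime_spanE) blast
  have "(\<Sum>d\<in>D. (x(e := t)) d *s d) = h"
    unfolding h by (rule sum.cong) (use assms in auto)
  then have "h + t *s e = (\<Sum>d\<in>insert e D. (x(e := t)) d *s d)"
    using assms by (simp add: add.commute)
  also have "\<dots> \<in> prime_span (insert e D)"
    by (rule prime_spanI) (use assms x in auto)
  finally show ?thesis .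
qed

text \<open>
  A basis minimising the number of vectors outside the kernel of \<open>f\<close> makes the values of \<open>f\<close> at
  these vectors linearly independent over the prime field: a relation \<open>f v = 0\<close> lets \<open>v\<close> replace
  one of them.
\<close>

lemma ex_basis_adapted_to_functional:
  assumes "Vector_Spaces.linear scale (*) f" and "finite E" and "independent E"
  shows "\<exists>E'. E' \<subseteq> prime_span E \<and> finite E' \<and> independent E' \<and> card E' = card E \<and> span E' = span E \<and>
    (\<forall>x. (\<forall>e\<in>E'. x e \<in> prime_field) \<longrightarrow> f (\<Sum>e\<in>E'. x e *s e) = 0 \<longrightarrow>
      (\<forall>e\<in>E'. f e \<noteq> 0 \<longrightarrow> x e = 0))"
  using assms(2,3)
proof (induction "card {e \<in> E. f e \<noteq> 0}" arbitrary: E rule: less_induct)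
  case less
  show ?case
  proof (cases "\<forall>x. (\<forall>e\<in>E. x e \<in> prime_field) \<longrightarrow> f (\<Sum>e\<in>E. x e *s e) = 0 \<longrightarrow>
      (\<forall>e\<in>E. f e \<noteq> 0 \<longrightarrow> x e = 0)")
    case True
    then show ?thesis using less.prems prime_span_base by blast
  next
    case False
    then obtain x e where x: "\<And>e. e \<in> E \<Longrightarrow> x e \<in> prime_field"
      and fx: "f (\<Sum>e\<in>E. x e *s e) = 0" and e: "e \<in> E" "f e \<noteq> 0" "x e \<noteq> 0"
      by blast
    define v where "v = (\<Sum>e\<in>E. x e *s e)"
    define E1 where "E1 = insert v (E - {e})"
    have v_prime: "v \<in> prime_span E" unfolding v_def by (rule prime_spanI) (rule x)
    have v_notin: "v \<notin> span (E - {e})"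
      unfolding v_def using less.prems e by (intro independent_combination_notin_span)
    have v_in: "v \<in> span E" using v_prime prime_span_subset_span by blast
    have ind: "independent E1" and sp: "span E1 = span E"
      unfolding E1_def using exchange_basis[OF less.prems(2) e(1) v_in v_notin] by auto
    have v_new: "v \<notin> E - {e}" using v_notin span_superset[of "E - {e}"] by blast
    have cardE1: "card E1 = card E"
      unfolding E1_def using v_new less.prems(1) e(1) by
      (simp add: card_Suc_Diff1 del: card_Diff_insert)
    have sub: "E1 \<subseteq> prime_span E"
      unfolding E1_def using v_prime prime_span_base less.prems by auto
    have "f v = 0" unfolding v_def by (rule fx)
    then have "{d \<in> E1. f d \<noteq> 0} \<subseteq> {d \<in> E. f d \<noteq> 0}" and "e \<notin> {d \<in> E1. f d \<noteq> 0}"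
      unfolding E1_def using e(2) by auto
    then have "{d \<in> E1. f d \<noteq> 0} \<subset> {d \<in> E. f d \<noteq> 0}"
      using e(1,2) by blast
    then have "card {d \<in> E1. f d \<noteq> 0} < card {d \<in> E. f d \<noteq> 0}"
      using less.prems(1) by (intro psubset_card_mono) auto
    moreover have "finite E1" unfolding E1_def using less.prems by simp
    ultimately obtain E' where "E' \<subseteq> prime_span E1" "finite E'" "independent E'" "card E' = card E1"
      "span E' = span E1" "\<forall>x. (\<forall>e\<in>E'. x e \<in> prime_field) \<longrightarrow> f (\<Sum>e\<in>E'. x e *s e) = 0 \<longrightarrow>
        (\<forall>e\<in>E'. f e \<noteq> 0 \<longrightarrow> x e = 0)"
      using less.hyps[of E1] ind by auto
    then show ?thesis
      using sp cardE1 prime_span_trans[OF sub] by (intro exI[of _ E']) auto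
  qed
qed

text \<open>The points are sliced by their coefficient \<open>t\<close> at \<open>e\<close>. As
  \<open>e\<close> is outside \<open>span D\<close>, slices for distinct \<open>t\<close> are
  disjoint, so the bounds \<open>m\<close> for the slices in \<open>T\<close> add up.\<close>

lemma card_prime_span_insert_ge:
  assumes "finite D" and "e \<notin> span D"
    and "T \<subseteq> prime_field" and "k \<le> card T"
    and "\<And>t. t \<in> T \<Longrightarrow> m \<le> card {h \<in> prime_span D. Q (h + t *s e)}"
  shows "k * m \<le> card {h \<in> prime_span (insert e D). Q h}"
proof -
  define S where "S t = {h \<in> prime_span D. Q (h + t *s e)}" for t
  have finT: "finite T" using assms(3) finite_prime_field[OF char] finite_subset by blast
  have finS: "finite (S t)" for t
    unfolding S_def using finite_prime_span[OF \<open>finite D\<close>] by simp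
  have eD: "e \<notin> D" using assms(2) span_superset[of D] by blast
  have inj: "inj_on (\<lambda>(t, h). h + t *s e) (Sigma T S)"
  proof (rule inj_onI, clarify)
    fix t h t' h' assume "h \<in> S t" "h' \<in> S t'" and eq: "h + t *s e = h' + t' *s e"
    then have "h \<in> span D" "h' \<in> span D"
      unfolding S_def using prime_span_subset_span by auto
    moreover have "(t - t') *s e = h' - h"
      using eq by (simp add: scale_left_diff_distrib algebra_simps)
    ultimately have "(t - t') *s e \<in> span D" by (simp add: span_diff)
    then have "t = t'" using assms(2) span_scale[of "(t - t') *s e" D "inverse (t - t')"]
      by (cases "t = t'") auto
    then show "t = t' \<and> h = h'" using eq by simp
  qed
  have "k * m \<le> card T * m" using assms(4) by simp
  also have "\<dots> \<le> (\<Sum>t\<in>T. card (S t))"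
    using assms(5) unfolding S_def by (intro sum_bounded_below[of T m, simplified]) simp
  also have "\<dots> = card (Sigma T S)" using finT finS by simp
  also have "\<dots> = card ((\<lambda>(t, h). h + t *s e) ` Sigma T S)"
    using inj by (simp add: card_image)
  also have "\<dots> \<le> card {h \<in> prime_span (insert e D). Q h}"
  proof (rule card_mono)
    show "finite {h \<in> prime_span (insert e D). Q h}"
      using finite_prime_span[of "insert e D"] \<open>finite D\<close> by simp
    show "(\<lambda>(t, h). h + t *s e) ` Sigma T S \<subseteq> {h \<in> prime_span (insert e D). Q h}"
      using prime_span_insert[OF \<open>finite D\<close> eD] assms(3) unfolding S_def by auto
  qed
  finally show ?thesis .
qed

text \<open>
  The values \<open>c i\<close> are arbitrary so that the induction can pass to the cosets of a hyperplane. The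
  \<open>a i\<close> express that the \<open>f i\<close> are linearly independent on the span of \<open>E\<close>.
\<close>

lemma card_prime_span_avoiding_hyperplanes:
  assumes lin: "\<And>i. i \<in> I \<Longrightarrow> Vector_Spaces.linear scale (*) (f i)"
    and "\<And>i j. i \<in> I \<Longrightarrow> j \<in> I \<Longrightarrow> f i (a j) = (if i = j then 1 else 0)"
    and "\<And>i. i \<in> I \<Longrightarrow> a i \<in> span E"
    and "finite E" and "independent E"
  shows "(CHAR('a) - 1) ^ card E \<le> card {h \<in> prime_span E. \<forall>i\<in>I. f i h \<noteq> c i}"
  using assms
proof (induction "card E" arbitrary: E I a c)
  case 0
  then have "E = {}" by simp
  \<comment> \<open>In the zero space \<open>a i\<close> would be 0, against
    \<open>f i (a i) = 1\<close>.\<close>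
  moreover have "I = {}"
  proof (rule ccontr)
    assume "I \<noteq> {}"
    then obtain i where i: "i \<in> I" by blast
    interpret f: Vector_Spaces.linear scale "(*)" "f i" using 0 i by blast
    have "a i = 0" using 0 i \<open>E = {}\<close> by auto
    then show False using 0(3)[OF i i] f.zero by simp
  qed
  moreover have "prime_span {} = {0}" unfolding prime_span_def by auto
  ultimately show ?case by simp
next
  case (Suc n)
  show ?case
  proof (cases "I = {}")
    case True
    obtain e where e: "e \<in> E" using Suc.hyps(2) by fastforce
    define D where "D = E - {e}"
    have E: "E = insert e D" and "finite D" and "card D = n" and "independent D" and "e \<notin> span D"
      using e Suc.hyps(2) Suc.prems independent_mono[of E D]
      unfolding D_def by (auto simp: dependent_def)
    have "(CHAR('a) - 1) ^ n \<le> card {h \<in> prime_span D. True}"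
      using Suc.hyps(1)[of D "{}"] \<open>card D = n\<close> \<open>finite D\<close> \<open>independent D\<close> by simp
    \<comment> \<open>With nothing to avoid, all \<open>CHAR('a)\<close> slices are available; one
      of them is given away.\<close>
    then have "(CHAR('a) - 1) * (CHAR('a) - 1) ^ n \<le> card {h \<in> prime_span E. True}"
      unfolding E using card_prime_field[OF char]
      by (intro card_prime_span_insert_ge[OF \<open>finite D\<close> \<open>e \<notin> span D\<close>, of prime_field]) auto
    then show ?thesis using True Suc.hyps(2) by (simp flip: Suc.hyps(2))
  next
    case False
    then obtain r where r: "r \<in> I" by blast
    interpret fr: Vector_Spaces.linear scale "(*)" "f r" using Suc.prems r by blast
    obtain B where B: "B \<subseteq> prime_span E" "finite B" "independent B" "card B = card E" "span B = span E"
      and adapted: "\<And>x e. (\<And>e. e \<in> B \<Longrightarrow> x e \<in> prime_field) \<Longrightarrow> f r (\<Sum>e\<in>B. x e *s e) = 0 \<Longrightarrow>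
        e \<in> B \<Longrightarrow> f r e \<noteq> 0 \<Longrightarrow> x e = 0"
      using ex_basis_adapted_to_functional[OF fr.linear_axioms Suc.prems(4,5)] by metis
    have "a r \<in> span B" using Suc.prems(3)[OF r] B by simp
    then obtain y where y: "a r = (\<Sum>e\<in>B. y e *s e)"
      using span_finite[OF \<open>finite B\<close>] by auto
    have "f r (a r) \<noteq> 0" using Suc.prems(2)[OF r r] by simp
    then have "(\<Sum>e\<in>B. y e * f r e) \<noteq> 0" unfolding y by (simp add: fr.sum fr.scale)
    \<comment> \<open>Both factors matter: \<open>y e\<close> nonzero keeps \<open>a r\<close> out
      of \<open>span D\<close>, so that the other functionals stay independent there;
      \<open>f r e\<close> nonzero makes the adapted basis \<open>B\<close> determine the coordinate
      at \<open>e\<close>.\<close>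
    then obtain e where "e \<in> B" "y e * f r e \<noteq> 0"
      by (rule sum.not_neutral_contains_not_neutral)
    then have e: "e \<in> B" "y e \<noteq> 0" "f r e \<noteq> 0" by auto
    define D where "D = B - {e}"
    have BD: "B = insert e D" and "finite D" and "card D = n" and "independent D"
      and eD: "e \<notin> span D"
      using e Suc.hyps(2) B independent_mono[of B D]
      unfolding D_def by (auto simp: dependent_def)
    have ar: "a r \<notin> span D"
      unfolding D_def y using B e by (intro independent_combination_notin_span)
    have "span (insert (a r) D) = span B"
      unfolding D_def using exchange_basis(2)[OF \<open>independent B\<close> \<open>e \<in> B\<close>] \<open>a r \<in> span B\<close> ar D_def
      by blast
    then have "\<forall>i\<in>I. \<exists>k. a i - k *s a r \<in> span D"
      using Suc.prems(3) B by (simp flip: span_breakdown_eq)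
    then obtain k where k: "\<And>i. i \<in> I \<Longrightarrow> a i - k i *s a r \<in> span D" by metis
    \<comment> \<open>The projection of \<open>a i\<close> to \<open>span D\<close> along
      \<open>a r\<close>. The functionals other than \<open>f r\<close> vanish at
      \<open>a r\<close>, so duality survives.\<close>
    define a' where "a' i = a i - k i *s a r" for i
    have dual: "f i (a' j) = (if i = j then 1 else 0)" if "i \<in> I - {r}" "j \<in> I - {r}" for i j
    proof -
      interpret fi: Vector_Spaces.linear scale "(*)" "f i" using Suc.prems that by blast
      show ?thesis unfolding a'_def fi.diff fi.scale using Suc.prems(2) that r by simp
    qed
    have IH: "(CHAR('a) - 1) ^ n \<le> card {h \<in> prime_span D. \<forall>i\<in>I - {r}. f i h \<noteq> d i}" for d
      using Suc.hyps(1)[of D "I - {r}" a' d] \<open>card D = n\<close> \<open>finite D\<close> \<open>independent D\<close> dual k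
        Suc.prems(1) unfolding a'_def by auto
    \<comment> \<open>The heights \<open>t\<close> of the slices that meet the hyperplane
      \<open>f r = c r\<close>.\<close>
    define U where "U = {t \<in> prime_field. \<exists>h\<in>prime_span D. f r (h + t *s e) = c r}"
    have U: "t = t'" if "t \<in> U" "t' \<in> U" for t t'
    proof -
      from that obtain h h' where h: "h \<in> prime_span D" "h' \<in> prime_span D"
        and t: "t \<in> prime_field" "t' \<in> prime_field"
        and eq: "f r (h + t *s e) = c r" "f r (h' + t' *s e) = c r"
        unfolding U_def by blast
      obtain x where x: "h = (\<Sum>d\<in>D. x d *s d)" "\<And>d. d \<in> D \<Longrightarrow> x d \<in> prime_field"
        using h(1) by (rule prime_spanE) blast
      obtain x' where x': "h' = (\<Sum>d\<in>D. x' d *s d)" "\<And>d. d \<in> D \<Longrightarrow> x' d \<in> prime_field"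
        using h(2) by (rule prime_spanE) blast
      \<comment> \<open>The coefficients over \<open>B\<close> of the difference of the two points.
        It is killed by \<open>f r\<close>, so adaptedness forces its coefficient
        \<open>t - t'\<close> at \<open>e\<close> to vanish.\<close>
      define z where "z = (\<lambda>d. x d - x' d)(e := t - t')"
      have "e \<notin> D" unfolding D_def by simp
      then have "(\<Sum>d\<in>D. z d *s d) = (\<Sum>d\<in>D. (x d - x' d) *s d)"
        unfolding z_def by (intro sum.cong) auto
      then have "(\<Sum>d\<in>B. z d *s d) = (h + t *s e) - (h' + t' *s e)"
        unfolding BD x(1) x'(1) using \<open>finite D\<close> \<open>e \<notin> D\<close>
        by (simp add: z_def scale_left_diff_distrib sum_subtractf algebra_simps)
      then have "f r (\<Sum>d\<in>B. z d *s d) = 0" using eq by (simp add: fr.diff)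
      moreover have "z d \<in> prime_field" if "d \<in> B" for d
        using that x(2) x'(2) t prime_field_diff[OF char] unfolding z_def BD by auto
      ultimately have "z e = 0" using adapted[of z e] e by blast
      then show ?thesis unfolding z_def by simp
    qed
    have finP: "finite (prime_field :: 'a set)" using finite_prime_field[OF char] .
    have "U \<subseteq> prime_field" unfolding U_def by blast
    then have "finite U" using finP by (rule finite_subset)
    then have "card U \<le> 1" using U card_le_Suc0_iff_eq[of U] by simp
    then have cardT: "CHAR('a) - 1 \<le> card (prime_field - U)"
      using card_Diff_subset[OF \<open>finite U\<close> \<open>U \<subseteq> prime_field\<close>] card_prime_field[OF char] by simp
    have "(CHAR('a) - 1) * (CHAR('a) - 1) ^ n \<le> card {h \<in> prime_span B. \<forall>i\<in>I. f i h \<noteq> c i}"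
      unfolding BD
    proof (rule card_prime_span_insert_ge[OF \<open>finite D\<close> eD _ cardT])
      fix t assume t: "t \<in> prime_field - U"
      \<comment> \<open>By linearity, avoiding \<open>c i\<close> on slice \<open>t\<close> means
        avoiding a shifted value on \<open>prime_span D\<close>. The index \<open>r\<close> takes
        care of itself because \<open>t\<close> is outside \<open>U\<close>.\<close>
      have "{h \<in> prime_span D. \<forall>i\<in>I - {r}. f i h \<noteq> c i - t * f i e}
        \<subseteq> {h \<in> prime_span D. \<forall>i\<in>I. f i (h + t *s e) \<noteq> c i}"
      proof clarify
        fix h i assume h: "h \<in> prime_span D" "\<forall>i\<in>I - {r}. f i h \<noteq> c i - t * f i e"
          and i: "i \<in> I" "f i (h + t *s e) = c i"
        interpret fi: Vector_Spaces.linear scale "(*)" "f i" using Suc.prems i by blast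
        have "f i h = c i - t * f i e" using i(2) by (simp add: fi.add fi.scale algebra_simps)
        then have "i = r" using h i by blast
        then show False using i h t unfolding U_def by blast
      qed
      then have "card {h \<in> prime_span D. \<forall>i\<in>I - {r}. f i h \<noteq> c i - t * f i e}
        \<le> card {h \<in> prime_span D. \<forall>i\<in>I. f i (h + t *s e) \<noteq> c i}"
        using finite_prime_span[OF \<open>finite D\<close>] by (intro card_mono) auto
      then show "(CHAR('a) - 1) ^ n \<le> card {h \<in> prime_span D. \<forall>i\<in>I. f i (h + t *s e) \<noteq> c i}"
        by (rule order_trans[OF IH])
    qed auto
    also have "\<dots> \<le> card {h \<in> prime_span E. \<forall>i\<in>I. f i h \<noteq> c i}"
      using finite_prime_span[OF \<open>finite E\<close>] prime_span_trans[OF B(1)]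
      by (intro card_mono) auto
    finally show ?thesis by (simp flip: Suc.hyps(2))
  qed
qed

end

section \<open>Maximal ideals of a commutative ring\<close>

text \<open>Negatives come from multiplication by -1. The zero ring has 0 = 1, hence no proper
  ideals and later no functionals to avoid.\<close>

definition proper_ideal :: "'a::{comm_ring, comm_monoid_mult} set \<Rightarrow> bool"
  where "proper_ideal M \<longleftrightarrow> 0 \<in> M \<and> (\<forall>x\<in>M. \<forall>y\<in>M. x + y \<in> M) \<and> (\<forall>x\<in>M. \<forall>b. b * x \<in> M) \<and> 1 \<notin> M"

definition maximal_ideal :: "'a::{comm_ring, comm_monoid_mult} set \<Rightarrow> bool"
  where "maximal_ideal M \<longleftrightarrow> proper_ideal M \<and> (\<forall>N. proper_ideal N \<longrightarrow> M \<subseteq> N \<longrightarrow> N = M)"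

text \<open>By maximality \<open>M\<close> and \<open>x\<close> generate the whole ring, so
  \<open>1 = m + b * x\<close> with \<open>m\<close> in \<open>M\<close>; multiplying by
  \<open>y\<close> gives the claim.\<close>

lemma maximal_ideal_prime:
  assumes "maximal_ideal M" and "x * y \<in> M" and "x \<notin> M"
  shows "y \<in> M"
proof -
  have M: "proper_ideal M" using assms(1) unfolding maximal_ideal_def by blast
  define N where "N = {m + b * x | m b. m \<in> M}"
  have MN: "M \<subseteq> N"
  proof
    fix m assume "m \<in> M"
    then show "m \<in> N" unfolding N_def by (intro CollectI exI[of _ m] exI[of _ 0]) simp
  qed
  have "x \<in> N"
    unfolding N_def using M by (intro CollectI exI[of _ 0] exI[of _ 1]) (simp add: proper_ideal_def)
  then have "N \<noteq> M" using assms(3) by blast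
  then have "\<not> proper_ideal N" using assms(1) MN unfolding maximal_ideal_def by blast
  moreover have "0 \<in> N" using M MN unfolding proper_ideal_def by blast
  moreover have "u + v \<in> N" if "u \<in> N" "v \<in> N" for u v
  proof -
    from that obtain m b m' b' where "u = m + b * x" "v = m' + b' * x" "m \<in> M" "m' \<in> M"
      unfolding N_def by blast
    then have "u + v = (m + m') + (b + b') * x" "m + m' \<in> M"
      using M unfolding proper_ideal_def by (auto simp: algebra_simps)
    then show ?thesis unfolding N_def by blast
  qed
  moreover have "c * u \<in> N" if "u \<in> N" for u c
  proof -
    from that obtain m b where "u = m + b * x" "m \<in> M" unfolding N_def by blast
    then have "c * u = c * m + (c * b) * x" "c * m \<in> M"
      using M unfolding proper_ideal_def by (auto simp: algebra_simps)
    then show ?thesis unfolding N_def by blast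
  qed
  ultimately have "1 \<in> N" unfolding proper_ideal_def by blast
  then obtain m b where mb: "1 = m + b * x" "m \<in> M" unfolding N_def by blast
  have "y = (m + b * x) * y" using mb(1) by simp
  also have "\<dots> = y * m + b * (x * y)" by (simp add: algebra_simps)
  also have "\<dots> \<in> M" using M mb(2) assms(2) unfolding proper_ideal_def by blast
  finally show ?thesis .
qed

text \<open>Zorn's lemma on the proper ideals containing \<open>x\<close>: the multiples of
  \<open>x\<close> form one because \<open>x\<close> is no unit, and the union of a nonempty chain
  still misses 1.\<close>

lemma nonunit_in_maximal_ideal:
  fixes x :: "'a::{comm_ring, comm_monoid_mult}"
  assumes "\<not> x dvd 1"
  shows "\<exists>M. maximal_ideal M \<and> x \<in> M"
proof -
  define \<A> where "\<A> = {M. proper_ideal M \<and> x \<in> M}"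
  have "range (\<lambda>b. b * x) \<in> \<A>"
    unfolding \<A>_def proper_ideal_def
  proof (intro CollectI conjI ballI allI)
    show "0 \<in> range (\<lambda>b. b * x)" by (metis mult_zero_left rangeI)
    show "x \<in> range (\<lambda>b. b * x)" by (metis mult_1_left rangeI)
    show "1 \<notin> range (\<lambda>b. b * x)" using assms by (metis dvdI imageE mult.commute)
    fix u assume "u \<in> range (\<lambda>b. b * x)"
    then obtain b where b: "u = b * x" by blast
    show "c * u \<in> range (\<lambda>b. b * x)" for c unfolding b by (metis mult.assoc rangeI)
    fix v assume "v \<in> range (\<lambda>b. b * x)"
    then obtain d where "v = d * x" by blast
    then have "u + v = (b + d) * x" using b by (simp add: distrib_right)
    then show "u + v \<in> range (\<lambda>b. b * x)" by blast
  qed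
  then have "\<A> \<noteq> {}" by blast
  moreover have "\<Union>\<C> \<in> \<A>" if "\<C> \<noteq> {}" "subset.chain \<A> \<C>" for \<C>
  proof -
    have sub: "\<C> \<subseteq> \<A>" and chain: "\<And>M N. M \<in> \<C> \<Longrightarrow> N \<in> \<C> \<Longrightarrow> M \<subseteq> N \<or> N \<subseteq> M"
      using that(2) unfolding subset.chain_def by auto
    have "u + v \<in> \<Union>\<C>" if uv: "u \<in> \<Union>\<C>" "v \<in> \<Union>\<C>" for u v
    proof -
      obtain M where "M \<in> \<C>" "u \<in> M" "v \<in> M" using uv chain by blast
      then show ?thesis using sub unfolding \<A>_def proper_ideal_def by blast
    qed
    then show ?thesis
      using sub that(1) unfolding \<A>_def proper_ideal_def by blast
  qed
  ultimately obtain M where M: "M \<in> \<A>" "\<And>N. N \<in> \<A> \<Longrightarrow> M \<subseteq> N \<Longrightarrow> N = M"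
    using subset_Zorn_nonempty[of \<A>] by metis
  then have "maximal_ideal M \<and> x \<in> M" unfolding maximal_ideal_def \<A>_def by blast
  then show ?thesis by blast
qed

text \<open>Distinct maximal ideals are not nested, so each \<open>N\<close> has an element outside
  \<open>M\<close>. The product of these stays outside \<open>M\<close> because \<open>M\<close> is
  prime.\<close>

lemma ex_separating_element:
  assumes "finite \<N>" and "maximal_ideal M" and "\<And>N. N \<in> \<N> \<Longrightarrow> maximal_ideal N \<and> N \<noteq> M"
  shows "\<exists>a. a \<notin> M \<and> (\<forall>N\<in>\<N>. a \<in> N)"
  using assms(1,3)
proof (induction \<N>)
  case empty
  then show ?case using assms(2) unfolding maximal_ideal_def proper_ideal_def by blast
next
  case (insert N \<N>)
  then obtain a where a: "a \<notin> M" "\<forall>N\<in>\<N>. a \<in> N" by auto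
  have N: "maximal_ideal N" "N \<noteq> M" using insert.prems by auto
  then have "\<not> N \<subseteq> M" using assms(2) unfolding maximal_ideal_def by blast
  then obtain b where b: "b \<in> N" "b \<notin> M" by blast
  have "a * b \<notin> M" using maximal_ideal_prime[OF assms(2)] a b by blast
  moreover have "a * b \<in> K" if "K \<in> insert N \<N>" for K
    using that a b insert.prems unfolding maximal_ideal_def proper_ideal_def
    by (metis insert_iff mult.commute)
  ultimately show ?case by blast
qed

section \<open>Maximal ideals of a finite-dimensional commutative algebra\<close>

locale fin_dim_comm_algebra = fin_dim_algebra \<phi>
  for \<phi> :: "'f::field \<Rightarrow> 'a::{comm_ring, comm_monoid_mult}"
begin

lemma proper_ideal_subspace: "proper_ideal M \<Longrightarrow> subspace M"
  unfolding proper_ideal_def subspace_def by (auto simp: scale_def)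

text \<open>Take \<open>a M\<close> in every other member of the family but not in \<open>M\<close>,
  and \<open>f M\<close> vanishing on \<open>M\<close> with value 1 at \<open>a M\<close>. For
  \<open>N\<close> other than \<open>M\<close>, \<open>a N\<close> lies in \<open>M\<close> and is
  killed by \<open>f M\<close>.\<close>

lemma maximal_ideals_dual_family:
  assumes "finite \<N>" and max: "\<And>M. M \<in> \<N> \<Longrightarrow> maximal_ideal M"
  shows "\<exists>f a. \<forall>M\<in>\<N>. Vector_Spaces.linear scale (*) (f M) \<and> (\<forall>x\<in>M. f M x = 0) \<and>
    (\<forall>N\<in>\<N>. f M (a N) = (if M = N then 1 else 0))"
proof -
  have "\<forall>M\<in>\<N>. \<exists>a. a \<notin> M \<and> (\<forall>N\<in>\<N> - {M}. a \<in> N)"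
    using ex_separating_element assms by (metis DiffE finite_Diff singletonI)
  then obtain a where a: "\<And>M. M \<in> \<N> \<Longrightarrow> a M \<notin> M"
      "\<And>M N. M \<in> \<N> \<Longrightarrow> N \<in> \<N> \<Longrightarrow> N \<noteq> M \<Longrightarrow> a M \<in> N"
    by (metis DiffI singletonD)
  have "\<forall>M\<in>\<N>. \<exists>f. Vector_Spaces.linear scale (*) f \<and> (\<forall>x\<in>M. f x = 0) \<and> f (a M) = 1"
  proof
    fix M assume M: "M \<in> \<N>"
    then have "subspace M"
      using max proper_ideal_subspace unfolding maximal_ideal_def by blast
    then show "\<exists>f. Vector_Spaces.linear scale (*) f \<and> (\<forall>x\<in>M. f x = 0) \<and> f (a M) = 1"
      using a(1)[OF M] by (rule ex_functional_vanishing_on_subspace)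
  qed
  then obtain f where "\<And>M. M \<in> \<N> \<Longrightarrow>
      Vector_Spaces.linear scale (*) (f M) \<and> (\<forall>x\<in>M. f M x = 0) \<and> f M (a M) = 1"
    by metis
  then show ?thesis using a(2) by (intro exI[of _ f] exI[of _ a]) auto
qed

text \<open>Distinct maximal ideals yield independent vectors \<open>a M\<close>, so every finite
  set of them is at most as large as a finite spanning set.\<close>

lemma finite_maximal_ideals: "finite {M :: 'a set. maximal_ideal M}"
proof -
  obtain B where B: "finite B" "span B = UNIV" using fin_dim by blast
  have "card \<N> \<le> card B" if N: "finite \<N>" "\<N> \<subseteq> {M :: 'a set. maximal_ideal M}" for \<N>
  proof -
    obtain f a where fa: "\<And>M. M \<in> \<N> \<Longrightarrow> Vector_Spaces.linear scale (*) (f M)"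
        "\<And>M N. M \<in> \<N> \<Longrightarrow> N \<in> \<N> \<Longrightarrow> f M (a N) = (if M = N then 1 else 0)"
      using maximal_ideals_dual_family[OF N(1)] N(2) by (metis mem_Collect_eq subsetD)
    note ind = dual_family_imp_independent[OF fa]
    show ?thesis
      using independent_span_bound[OF B(1) ind(2)] B(2) card_image[OF ind(1)] by simp
  qed
  then show ?thesis
    using finite_if_finite_subsets_card_bdd[of "{M :: 'a set. maximal_ideal M}" "card B"] by blast
qed

end

section \<open>Units in the additive subgroup\<close>

theorem mainTheorem3:
  fixes \<phi> :: "'f::field \<Rightarrow> 'a::{comm_ring, comm_monoid_mult}"
    and H :: "'a set"
    and n p :: nat
  assumes "fin_dim_algebra \<phi>"
    and "add_subgroup H"
    and "module.span (algebra_over_field.scale \<phi>) H = UNIV"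
    and "n = vector_space.dim (algebra_over_field.scale \<phi>) (UNIV :: 'a set)"
    and "p = CHAR('f)"
    and "p \<noteq> 0"
  shows "infinite {u \<in> H. u dvd 1} \<or> (p - 1) ^ n \<le> card {u \<in> H. u dvd 1}"
proof -
  interpret fin_dim_comm_algebra \<phi>
    using assms(1) by (simp add: fin_dim_comm_algebra_def)
  interpret positive_char_vector_space scale
    using assms by unfold_locales simp
  \<comment> \<open>The basis is chosen inside \<open>H\<close> so that its combinations over the
    prime field stay in \<open>H\<close>.\<close>
  obtain E where E: "E \<subseteq> H" "independent E" "H \<subseteq> span E" "card E = dim H"
    using basis_exists by blast
  have spanE: "span E = UNIV"
    using E(3) assms(3) span_minimal[OF E(3)] by auto
  have finE: "finite E"
    using fin_dim independent_span_bound[OF _ E(2)] by auto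
  have cardE: "card E = n" using E(4) assms(3,4) by (metis dim_span)
  \<comment> \<open>Scaling by the image of a natural number is repeated addition, so it preserves
    \<open>H\<close> even if \<open>H\<close> is not a subspace.\<close>
  have smult: "scale (of_nat k) x \<in> H" if "x \<in> H" for k x
    by (induction k) (use that assms(2) in \<open>auto simp: add_subgroup_def scale_left_distrib\<close>)
  have sums: "sum g A \<in> H" if "\<And>i. i \<in> A \<Longrightarrow> g i \<in> H" for g and A :: "'a set"
    using that
    by (induction A rule: infinite_finite_induct) (use assms(2) in \<open>auto simp: add_subgroup_def\<close>)
  have PH: "prime_span E \<subseteq> H"
  proof
    fix v assume "v \<in> prime_span E"
    then obtain x where v: "v = (\<Sum>e\<in>E. scale (x e) e)" and x: "\<And>e. e \<in> E \<Longrightarrow> x e \<in> prime_field"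
      by (rule prime_spanE) blast
    have "scale (x e) e \<in> H" if e: "e \<in> E" for e
    proof -
      obtain k where "x e = of_nat k" using x[OF e] unfolding prime_field_def by blast
      then show ?thesis using smult E(1) e by auto
    qed
    then show "v \<in> H" unfolding v by (rule sums)
  qed
  let ?\<M> = "{M :: 'a set. maximal_ideal M}"
  obtain f a where fa: "\<forall>M\<in>?\<M>. Vector_Spaces.linear scale (*) (f M) \<and> (\<forall>x\<in>M. f M x = 0) \<and>
      (\<forall>N\<in>?\<M>. f M (a N) = (if M = N then 1 else 0))"
    using maximal_ideals_dual_family[OF finite_maximal_ideals] by auto
  then have f: "\<And>M. M \<in> ?\<M> \<Longrightarrow> Vector_Spaces.linear scale (*) (f M)"
      "\<And>M N. M \<in> ?\<M> \<Longrightarrow> N \<in> ?\<M> \<Longrightarrow> f M (a N) = (if M = N then 1 else 0)"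
      "\<And>M x. M \<in> ?\<M> \<Longrightarrow> x \<in> M \<Longrightarrow> f M x = 0"
    by blast+
  have "(p - 1) ^ n \<le> card {h \<in> prime_span E. \<forall>M\<in>?\<M>. f M h \<noteq> 0}"
    using card_prime_span_avoiding_hyperplanes[of ?\<M> f a E "\<lambda>_. 0", OF f(1,2) _ finE E(2)]
    unfolding spanE cardE assms(5) by blast
  \<comment> \<open>Since \<open>f M\<close> vanishes on \<open>M\<close>, a point outside all the
    kernels lies in no maximal ideal and is therefore a unit.\<close>
  moreover have "{h \<in> prime_span E. \<forall>M\<in>?\<M>. f M h \<noteq> 0} \<subseteq> {u \<in> H. u dvd 1}"
  proof clarify
    fix h assume h: "h \<in> prime_span E" "\<forall>M\<in>?\<M>. f M h \<noteq> 0"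
    have "h dvd 1"
    proof (rule ccontr)
      assume "\<not> h dvd 1"
      then obtain M where "maximal_ideal M" "h \<in> M" using nonunit_in_maximal_ideal by blast
      then show False using f(3)[of M h] h(2) by simp
    qed
    then show "h \<in> H \<and> h dvd 1" using h(1) PH by blast
  qed
  \<comment> \<open>Monotonicity of \<open>card\<close> needs a finite set of units; the infinite
    case is the other alternative.\<close>
  ultimately show ?thesis
    using card_mono[of "{u \<in> H. u dvd 1}" "{h \<in> prime_span E. \<forall>M\<in>?\<M>. f M h \<noteq> 0}"] by linarith
qed

end
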